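(* Let $G$ be a graph and let $\hat{G}$ be the cone over $G$. Then $$\varepsilon(\hat{G}) = \varepsilon(G).$$
   Context: Graphs are finite, simple, undirected, with at least one vertex. The cone $\hat G$ over $G$ is the graph obtained from $G$ by adding one new vertex adjacent to all vertices of $G$. For a graph $G$ with vertex set $[n]$, $\mathrm{Sym}(G)=\mathbb{R}^{V(G)+E(G)}$ is the space of partially specified symmetric $n\times n$ real matrices: $A\in\mathrm{Sym}(G)$ specifies the diagonal entries $A_{ii}$ and the entries $A_{ij}=A_{ji}$ for $\{i,j\}\in E(G)$, the others being unspecified. $\mathrm{tr}(A)=\sum_i A_{ii}$, and $I_n$ also denotes the image of the identity matrix in $\mathrm{Sym}(G)$ (diagonal entries $1$, edge entries $0$). $\Sigma(G)$ is the set of $A\in\mathrm{Sym}(G)$ for which there is a real symmetric positive semidefinite (PSD) $n\times n$ matrix agreeing with $A$ on all specified entries. $\mathcal{P}(G)$ is the set of $A\in \mathrm{Sym}(G)$ such that for every maximal clique $K$ of $G$ the (fully specified) principal submatrix of $A$ indexed by $K$ is PSD. $\bar{\mathcal{P}}(G)=\{A\in\mathcal{P}(G):\mathrm{tr}(A)=1\}$. The conical distance $\varepsilon(G)$ is the smallest real $\varepsilon\ge 0$ such that $M+\varepsilon I_n\in\Sigma(G)$ for all $M\in\bar{\mathcal{P}}(G)$. *)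

theory Defs
  imports "HOL-Analysis.Analysis"
begin

record 'a ugraph =
  verts :: "'a set"
  edges :: "'a set set"

definition simple_graph :: "'a ugraph \<Rightarrow> bool" where
  "simple_graph G \<longleftrightarrow> finite (verts G) \<and> verts G \<noteq> {} \<and>
     (\<forall>e\<in>edges G. e \<subseteq> verts G \<and> card e = 2)"

definition clique :: "'a ugraph \<Rightarrow> 'a set \<Rightarrow> bool" where
  "clique G K \<longleftrightarrow> K \<subseteq> verts G \<and> (\<forall>i\<in>K. \<forall>j\<in>K. i \<noteq> j \<longrightarrow> {i, j} \<in> edges G)"

definition maximal_clique :: "'a ugraph \<Rightarrow> 'a set \<Rightarrow> bool" where
  "maximal_clique G K \<longleftrightarrow> clique G K \<and> (\<forall>L. clique G L \<and> K \<subseteq> L \<longrightarrow> L = K)"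

text \<open>The cone lives on the option type: \<open>None\<close> is the new vertex, \<open>Some v\<close> the copy of \<open>v\<close>.\<close>

definition cone_graph :: "'a ugraph \<Rightarrow> 'a option ugraph" where
  "cone_graph G = \<lparr>verts = insert None (Some ` verts G),
             edges = (\<lambda>e. Some ` e) ` edges G \<union> {{None, Some v} |v. v \<in> verts G}\<rparr>"

text \<open>A matrix with rows and columns indexed by a finite set \<open>S\<close> is a function whose values
  outside \<open>S \<times> S\<close> are irrelevant.\<close>

definition psd_on :: "'a set \<Rightarrow> ('a \<Rightarrow> 'a \<Rightarrow> real) \<Rightarrow> bool" where
  "psd_on S M \<longleftrightarrow> (\<forall>i\<in>S. \<forall>j\<in>S. M i j = M j i) \<and>
     (\<forall>x. 0 \<le> (\<Sum>i\<in>S. \<Sum>j\<in>S. x i * M i j * x j))"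

text \<open>The space of real families indexed by the disjoint union of vertices and edges. As in
  \<^theory>\<open>HOL-Library.FuncSet\<close>, members are \<open>undefined\<close> off the index set, so that
  equality of functions is equality of partial matrices.\<close>

definition Sym_sp :: "'a ugraph \<Rightarrow> ('a + 'a set \<Rightarrow> real) set" where
  "Sym_sp G = (\<Pi>\<^sub>E k\<in>verts G <+> edges G. UNIV)"

text \<open>Only meaningful if \<open>i = j\<close> is a vertex or \<open>{i, j}\<close> is an edge.\<close>

definition entry :: "('a + 'a set \<Rightarrow> real) \<Rightarrow> 'a \<Rightarrow> 'a \<Rightarrow> real" where
  "entry A i j = (if i = j then A (Inl i) else A (Inr {i, j}))"

definition ptrace :: "'a ugraph \<Rightarrow> ('a + 'a set \<Rightarrow> real) \<Rightarrow> real" where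
  "ptrace G A = (\<Sum>i\<in>verts G. A (Inl i))"

definition pident :: "'a ugraph \<Rightarrow> 'a + 'a set \<Rightarrow> real" where
  "pident G = restrict (case_sum (\<lambda>_. 1) (\<lambda>_. 0)) (verts G <+> edges G)"

definition padd :: "'a ugraph \<Rightarrow> ('a + 'a set \<Rightarrow> real) \<Rightarrow> ('a + 'a set \<Rightarrow> real) \<Rightarrow> 'a + 'a set \<Rightarrow> real" where
  "padd G A B = restrict (\<lambda>k. A k + B k) (verts G <+> edges G)"

definition pscale :: "'a ugraph \<Rightarrow> real \<Rightarrow> ('a + 'a set \<Rightarrow> real) \<Rightarrow> 'a + 'a set \<Rightarrow> real" where
  "pscale G c A = restrict (\<lambda>k. c * A k) (verts G <+> edges G)"

definition Sigma_cone :: "'a ugraph \<Rightarrow> ('a + 'a set \<Rightarrow> real) set" where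
  "Sigma_cone G = {A \<in> Sym_sp G. \<exists>M. psd_on (verts G) M \<and>
     (\<forall>i\<in>verts G. M i i = entry A i i) \<and>
     (\<forall>i j. {i, j} \<in> edges G \<longrightarrow> M i j = entry A i j)}"

definition P_cone :: "'a ugraph \<Rightarrow> ('a + 'a set \<Rightarrow> real) set" where
  "P_cone G = {A \<in> Sym_sp G. \<forall>K. maximal_clique G K \<longrightarrow> psd_on K (entry A)}"

definition P_bar :: "'a ugraph \<Rightarrow> ('a + 'a set \<Rightarrow> real) set" where
  "P_bar G = {A \<in> P_cone G. ptrace G A = 1}"

definition shift_ok :: "'a ugraph \<Rightarrow> real \<Rightarrow> bool" where
  "shift_ok G \<epsilon> \<longleftrightarrow> 0 \<le> \<epsilon> \<and>
     (\<forall>M\<in>P_bar G. padd G M (pscale G \<epsilon> (pident G)) \<in> Sigma_cone G)"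

text \<open>For a simple graph the minimum is attained; see \<open>conical_distance_least\<close> below.\<close>

definition conical_distance :: "'a ugraph \<Rightarrow> real" where
  "conical_distance G = (LEAST \<epsilon>. shift_ok G \<epsilon>)"


lemma simple_graph_cone:
  assumes "simple_graph G"
  shows "simple_graph (cone_graph G)"
  using assms unfolding simple_graph_def cone_graph_def
  by (auto simp: card_image)

lemma psd_on_diag:
  assumes "finite S" "psd_on S M" "i \<in> S"
  shows "0 \<le> M i i"
proof -
  have "0 \<le> (\<Sum>a\<in>S. \<Sum>b\<in>S. of_bool (a = i) * M a b * of_bool (b = i))"
    using conjunct2[OF assms(2)[unfolded psd_on_def], rule_format, of "\<lambda>a. of_bool (a = i)"] by simp
  also have "\<dots> = (\<Sum>a\<in>S. if a = i then (\<Sum>b\<in>S. if b = i then M a b else 0) else 0)"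
    by (intro sum.cong) (auto simp: of_bool_def intro!: sum.cong)
  also have "\<dots> = M i i" using assms by simp
  finally show ?thesis .
qed

lemma psd_on_entry:
  assumes "finite S" "psd_on S M" "i \<in> S" "j \<in> S"
  shows "2 * \<bar>M i j\<bar> \<le> M i i + M j j"
proof (cases "i = j")
  case True
  then show ?thesis using psd_on_diag[OF assms(1-3)] by simp
next
  case False
  have sym: "M j i = M i j" using assms unfolding psd_on_def by blast
  have q: "0 \<le> M i i + 2 * c * M i j + M j j" if c: "c * c = 1" for c :: real
  proof -
    define x where "x a = (if a = i then 1 else if a = j then c else 0)" for a
    have s: "(\<Sum>a\<in>S. x a * f a) = f i + c * f j" for f :: "_ \<Rightarrow> real"
    proof -
      have "(\<Sum>a\<in>S. x a * f a) = (\<Sum>a\<in>{i,j}. x a * f a)"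
        by (rule sum.mono_neutral_right) (use assms in \<open>auto simp: x_def\<close>)
      then show ?thesis using False by (simp add: x_def)
    qed
    have "0 \<le> (\<Sum>a\<in>S. \<Sum>b\<in>S. x a * M a b * x b)"
      using assms(2) unfolding psd_on_def by blast
    also have "\<dots> = (\<Sum>a\<in>S. x a * (\<Sum>b\<in>S. x b * M a b))"
      by (simp add: sum_distrib_left mult_ac)
    also have "\<dots> = M i i + c * M i j + c * (M j i + c * M j j)"
      by (simp only: s)
    also have "\<dots> = M i i + 2 * c * M i j + (c * c) * M j j"
      using sym by (simp add: algebra_simps)
    finally show ?thesis using c by simp
  qed
  from q[of 1] q[of "-1"] show ?thesis by simp
qed

lemma psd_on_subset:
  assumes "finite S" "psd_on S M" "T \<subseteq> S"
  shows "psd_on T M"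
  unfolding psd_on_def
proof (intro conjI allI)
  show "\<forall>i\<in>T. \<forall>j\<in>T. M i j = M j i" using assms unfolding psd_on_def by blast
  fix x :: "'a \<Rightarrow> real"
  define y where "y i = (if i \<in> T then x i else 0)" for i
  have "0 \<le> (\<Sum>i\<in>S. \<Sum>j\<in>S. y i * M i j * y j)"
    using assms(2) unfolding psd_on_def by blast
  also have "\<dots> = (\<Sum>i\<in>T. \<Sum>j\<in>S. y i * M i j * y j)"
    by (rule sum.mono_neutral_right) (use assms in \<open>auto simp: y_def\<close>)
  also have "\<dots> = (\<Sum>i\<in>T. \<Sum>j\<in>T. y i * M i j * y j)"
    by (intro sum.cong refl sum.mono_neutral_right) (use assms in \<open>auto simp: y_def\<close>)
  also have "\<dots> = (\<Sum>i\<in>T. \<Sum>j\<in>T. x i * M i j * x j)"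
    by (intro sum.cong) (auto simp: y_def)
  finally show "0 \<le> (\<Sum>i\<in>T. \<Sum>j\<in>T. x i * M i j * x j)" .
qed

lemma psd_on_add_diag:
  assumes "finite S" "psd_on S M" "0 \<le> c"
  shows "psd_on S (\<lambda>i j. M i j + (if i = j then c else 0))"
  unfolding psd_on_def
proof (intro conjI allI)
  show "\<forall>i\<in>S. \<forall>j\<in>S. M i j + (if i = j then c else 0) = M j i + (if j = i then c else 0)"
    using assms unfolding psd_on_def by auto
  fix x :: "'a \<Rightarrow> real"
  have "(\<Sum>i\<in>S. \<Sum>j\<in>S. x i * (M i j + (if i = j then c else 0)) * x j)
      = (\<Sum>i\<in>S. \<Sum>j\<in>S. x i * M i j * x j + (if i = j then c * (x i * x i) else 0))"
    by (intro sum.cong) (auto simp: algebra_simps)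
  also have "\<dots> = (\<Sum>i\<in>S. \<Sum>j\<in>S. x i * M i j * x j) + (\<Sum>i\<in>S. c * (x i * x i))"
    using assms(1) by (simp add: sum.distrib)
  also have "\<dots> \<ge> 0"
    using assms unfolding psd_on_def by (intro add_nonneg_nonneg) (auto intro: sum_nonneg)
  finally show "0 \<le> (\<Sum>i\<in>S. \<Sum>j\<in>S. x i * (M i j + (if i = j then c else 0)) * x j)" .
qed

lemma psd_on_bounded_add_card:
  assumes "finite S" "\<And>i j. i \<in> S \<Longrightarrow> j \<in> S \<Longrightarrow> B i j = B j i"
    and bound: "\<And>i j. i \<in> S \<Longrightarrow> j \<in> S \<Longrightarrow> \<bar>B i j\<bar> \<le> 1"
  shows "psd_on S (\<lambda>i j. B i j + (if i = j then real (card S) else 0))"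
  unfolding psd_on_def
proof (intro conjI allI)
  let ?n = "real (card S)"
  show "\<forall>i\<in>S. \<forall>j\<in>S. B i j + (if i = j then ?n else 0) = B j i + (if j = i then ?n else 0)"
    using assms(2) by auto
  fix x :: "'a \<Rightarrow> real"
  have nn: "0 \<le> x i * B i j * x j + (x i * x i + x j * x j) / 2" if "i \<in> S" "j \<in> S" for i j
  proof -
    have "\<bar>x i * B i j * x j\<bar> \<le> \<bar>x i\<bar> * \<bar>x j\<bar>"
      using mult_left_mono[OF bound[OF that], of "\<bar>x i\<bar> * \<bar>x j\<bar>"] by (simp add: abs_mult mult_ac)
    moreover have "2 * (\<bar>x i\<bar> * \<bar>x j\<bar>) \<le> x i * x i + x j * x j"
      using sum_squares_bound[of "\<bar>x i\<bar>" "\<bar>x j\<bar>"] by (simp add: power2_eq_square)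
    moreover have "\<bar>t\<bar> \<le> p \<Longrightarrow> 2 * p \<le> q \<Longrightarrow> 0 \<le> t + q / 2" for t p q :: real
      by linarith
    ultimately show ?thesis by blast
  qed
  have half: "(\<Sum>i\<in>S. \<Sum>j\<in>S. (x i * x i + x j * x j) / 2) = ?n * (\<Sum>i\<in>S. x i * x i)"
    by (simp add: add_divide_distrib sum.distrib sum_divide_distrib[symmetric] sum_distrib_left[symmetric])
  have "0 \<le> (\<Sum>i\<in>S. \<Sum>j\<in>S. x i * B i j * x j + (x i * x i + x j * x j) / 2)"
    using nn by (auto intro!: sum_nonneg)
  also have "\<dots> = (\<Sum>i\<in>S. \<Sum>j\<in>S. x i * B i j * x j) + ?n * (\<Sum>i\<in>S. x i * x i)"
    using half by (simp add: sum.distrib)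
  also have "\<dots> = (\<Sum>i\<in>S. \<Sum>j\<in>S. x i * B i j * x j + (if i = j then ?n * (x i * x i) else 0))"
    using assms(1) by (simp add: sum.distrib sum_distrib_left)
  also have "\<dots> = (\<Sum>i\<in>S. \<Sum>j\<in>S. x i * (B i j + (if i = j then ?n else 0)) * x j)"
    by (intro sum.cong) (auto simp: algebra_simps)
  finally show "0 \<le> (\<Sum>i\<in>S. \<Sum>j\<in>S. x i * (B i j + (if i = j then ?n else 0)) * x j)" .
qed

lemma clique_extends:
  assumes "simple_graph G" "clique G K"
  obtains L where "maximal_clique G L" "K \<subseteq> L"
proof -
  have "finite {L. clique G L}"
    using assms(1) by (auto simp: clique_def simple_graph_def intro: finite_subset[of _ "Pow (verts G)"])
  from finite_has_maximal2[OF this, of K] assms(2) obtain L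
    where "clique G L" "K \<subseteq> L" "\<And>L'. clique G L' \<Longrightarrow> L \<subseteq> L' \<Longrightarrow> L = L'" by auto
  with that show ?thesis unfolding maximal_clique_def by blast
qed

lemma edge_verts:
  assumes "simple_graph G" "{i, j} \<in> edges G"
  shows "i \<in> verts G" "j \<in> verts G" "i \<noteq> j"
proof -
  have e: "{i, j} \<subseteq> verts G" "card {i, j} = 2"
    using assms unfolding simple_graph_def by blast+
  then show "i \<in> verts G" "j \<in> verts G" by auto
  show "i \<noteq> j" using e(2) by auto
qed

lemma singleton_not_edge: "simple_graph G \<Longrightarrow> {i} \<notin> edges G"
  using edge_verts(3)[of G i i] by auto

lemma P_bar_clique_psd:
  assumes "simple_graph G" "A \<in> P_bar G" "clique G K"
  shows "psd_on K (entry A)"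
proof -
  from clique_extends[OF assms(1,3)] obtain L where L: "maximal_clique G L" "K \<subseteq> L" by blast
  have "L \<subseteq> verts G" using L by (simp add: maximal_clique_def clique_def)
  then have "finite L" using assms(1) unfolding simple_graph_def by (blast intro: finite_subset)
  moreover have "psd_on L (entry A)" using assms(2) L by (auto simp: P_bar_def P_cone_def)
  ultimately show ?thesis using L(2) by (rule psd_on_subset)
qed

lemma P_bar_diag:
  assumes "simple_graph G" "A \<in> P_bar G" "i \<in> verts G"
  shows "0 \<le> A (Inl i)" "A (Inl i) \<le> 1"
proof -
  have nn: "0 \<le> A (Inl k)" if "k \<in> verts G" for k
    using psd_on_diag[OF _ P_bar_clique_psd[OF assms(1,2), of "{k}"], of k] that
    by (auto simp: clique_def entry_def)
  show "0 \<le> A (Inl i)" using nn assms(3) .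
  have "A (Inl i) \<le> ptrace G A" unfolding ptrace_def
    by (rule member_le_sum) (use assms nn in \<open>auto simp: simple_graph_def\<close>)
  then show "A (Inl i) \<le> 1" using assms(2) by (simp add: P_bar_def)
qed

lemma P_bar_edge:
  assumes "simple_graph G" "A \<in> P_bar G" "{i, j} \<in> edges G"
  shows "\<bar>A (Inr {i, j})\<bar> \<le> 1"
proof -
  note ij = edge_verts[OF assms(1,3)]
  have "clique G {i, j}" using assms(3) ij by (auto simp: clique_def insert_commute)
  from psd_on_entry[OF _ P_bar_clique_psd[OF assms(1,2) this], of i j]
  have "2 * \<bar>A (Inr {i, j})\<bar> \<le> A (Inl i) + A (Inl j)" using ij by (simp add: entry_def)
  with P_bar_diag(2)[OF assms(1,2) ij(1)] P_bar_diag(2)[OF assms(1,2) ij(2)] show ?thesis by linarith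
qed

lemma shift_in_Sigma_iff:
  assumes "simple_graph G"
  shows "padd G A (pscale G \<epsilon> (pident G)) \<in> Sigma_cone G \<longleftrightarrow>
    (\<exists>M. psd_on (verts G) M \<and> (\<forall>i\<in>verts G. M i i = A (Inl i) + \<epsilon>) \<and>
      (\<forall>i j. {i, j} \<in> edges G \<longrightarrow> M i j = A (Inr {i, j})))"
proof -
  have "padd G A (pscale G \<epsilon> (pident G)) \<in> Sym_sp G"
    by (simp add: Sym_sp_def padd_def)
  moreover have "entry (padd G A (pscale G \<epsilon> (pident G))) i i = A (Inl i) + \<epsilon>" if "i \<in> verts G" for i
    using that by (simp add: entry_def padd_def pscale_def pident_def InlI)
  moreover have "entry (padd G A (pscale G \<epsilon> (pident G))) i j = A (Inr {i, j})" if "{i, j} \<in> edges G" for i j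
    using that edge_verts[OF assms that] by (simp add: entry_def padd_def pscale_def pident_def InrI)
  ultimately show ?thesis unfolding Sigma_cone_def by auto
qed

lemma shift_ok_card:
  assumes "simple_graph G"
  shows "shift_ok G (real (card (verts G)))"
  unfolding shift_ok_def shift_in_Sigma_iff[OF assms]
proof (intro conjI ballI)
  fix A assume A: "A \<in> P_bar G"
  let ?n = "real (card (verts G))"
  define B where "B i j = (if i = j then A (Inl i) else if {i, j} \<in> edges G then A (Inr {i, j}) else 0)" for i j
  have "psd_on (verts G) (\<lambda>i j. B i j + (if i = j then ?n else 0))"
  proof (rule psd_on_bounded_add_card)
    show "finite (verts G)" using assms by (simp add: simple_graph_def)
    show "B i j = B j i" for i j by (simp add: B_def insert_commute)
    show "\<bar>B i j\<bar> \<le> 1" if "i \<in> verts G" "j \<in> verts G" for i j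
      using P_bar_diag[OF assms A that(1)] P_bar_edge[OF assms A, of i j] by (auto simp: B_def)
  qed
  then show "\<exists>M. psd_on (verts G) M \<and> (\<forall>i\<in>verts G. M i i = A (Inl i) + ?n) \<and>
      (\<forall>i j. {i, j} \<in> edges G \<longrightarrow> M i j = A (Inr {i, j}))"
    by (rule exI[where P = "\<lambda>M. psd_on (verts G) M \<and> _ M", OF conjI])
      (auto simp: B_def singleton_not_edge[OF assms])
qed simp

lemma shift_ok_mono:
  assumes "simple_graph G" "shift_ok G d" "d \<le> e"
  shows "shift_ok G e"
  unfolding shift_ok_def shift_in_Sigma_iff[OF assms(1)]
proof (intro conjI ballI)
  show "0 \<le> e" using assms by (simp add: shift_ok_def)
  fix A assume "A \<in> P_bar G"
  then obtain M where M: "psd_on (verts G) M" "\<forall>i\<in>verts G. M i i = A (Inl i) + d"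
      "\<forall>i j. {i, j} \<in> edges G \<longrightarrow> M i j = A (Inr {i, j})"
    using assms(2) unfolding shift_ok_def shift_in_Sigma_iff[OF assms(1)] by blast
  have "psd_on (verts G) (\<lambda>i j. M i j + (if i = j then e - d else 0))"
    using psd_on_add_diag[OF _ M(1), of "e - d"] assms by (simp add: simple_graph_def)
  then show "\<exists>M. psd_on (verts G) M \<and> (\<forall>i\<in>verts G. M i i = A (Inl i) + e) \<and>
      (\<forall>i j. {i, j} \<in> edges G \<longrightarrow> M i j = A (Inr {i, j}))"
    by (rule exI[where P = "\<lambda>M. psd_on (verts G) M \<and> _ M", OF conjI])
      (use M in \<open>auto simp: singleton_not_edge[OF assms(1)]\<close>)
qed

lemma bounded_functions_subsequence:
  fixes f :: "nat \<Rightarrow> 'k \<Rightarrow> real"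
  assumes "finite D" "\<And>n k. k \<in> D \<Longrightarrow> \<bar>f n k\<bar> \<le> c"
  shows "\<exists>l r. strict_mono (r :: nat \<Rightarrow> nat) \<and> (\<forall>k\<in>D. (\<lambda>n. f (r n) k) \<longlonglongrightarrow> l k)"
proof -
  have bd: "bounded ((\<lambda>x. x k) ` range f)" if "k \<in> D" for k
    using assms(2)[OF that] by (auto simp: bounded_iff)
  obtain l r where r: "strict_mono (r :: nat \<Rightarrow> nat)"
    and l: "\<And>e. e > 0 \<Longrightarrow> eventually (\<lambda>n. \<forall>i\<in>D. dist (f (r n) i) (l i) < e) sequentially"
    using compact_lemma_general[OF assms(1), of "\<lambda>x k. x k" f "\<lambda>x. x"] bd by blast
  have "(\<lambda>n. f (r n) k) \<longlonglongrightarrow> l k" if "k \<in> D" for k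
    unfolding tendsto_iff using that by (blast intro: eventually_mono[OF l])
  with r show ?thesis by blast
qed

lemma shift_ok_limit:
  assumes G: "simple_graph G" and "0 \<le> e" and ok: "\<And>d. e < d \<Longrightarrow> shift_ok G d"
  shows "shift_ok G e"
  unfolding shift_ok_def shift_in_Sigma_iff[OF G]
proof (intro conjI ballI)
  show "0 \<le> e" by fact
  fix A assume A: "A \<in> P_bar G"
  let ?V = "verts G"
  have fin: "finite ?V" using G by (simp add: simple_graph_def)
  define h where "h n = inverse (real (Suc n))" for n
  have h: "0 < h n" "h n \<le> 1" for n by (simp_all add: h_def field_simps)
  have "\<forall>n. \<exists>M. psd_on ?V M \<and> (\<forall>i\<in>?V. M i i = A (Inl i) + (e + h n)) \<and>
      (\<forall>i j. {i, j} \<in> edges G \<longrightarrow> M i j = A (Inr {i, j}))"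
    using ok[of "e + h _"] A h(1) unfolding shift_ok_def shift_in_Sigma_iff[OF G] by simp
  then obtain M where M: "\<And>n. psd_on ?V (M n)"
      "\<And>n i. i \<in> ?V \<Longrightarrow> M n i i = A (Inl i) + (e + h n)"
      "\<And>n i j. {i, j} \<in> edges G \<Longrightarrow> M n i j = A (Inr {i, j})" by metis
  have bound: "\<bar>case_prod (M n) k\<bar> \<le> 2 + e" if "k \<in> ?V \<times> ?V" for n k
  proof -
    obtain i j where k: "k = (i, j)" "i \<in> ?V" "j \<in> ?V" using \<open>k \<in> _\<close> by auto
    show ?thesis
      using psd_on_entry[OF fin M(1) k(2,3), of n] M(2)[OF k(2), of n] M(2)[OF k(3), of n] h(2)[of n]
        P_bar_diag[OF G A k(2)] P_bar_diag[OF G A k(3)] k(1) by simp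
  qed
  have "\<exists>l r. strict_mono (r :: nat \<Rightarrow> nat) \<and> (\<forall>k\<in>?V \<times> ?V. (\<lambda>n. case_prod (M (r n)) k) \<longlonglongrightarrow> l k)"
    by (rule bounded_functions_subsequence[where f = "\<lambda>n. case_prod (M n)"])
      (use fin in simp, rule bound)
  then obtain l r where r: "strict_mono (r :: nat \<Rightarrow> nat)"
    and lk: "\<forall>k\<in>?V \<times> ?V. (\<lambda>n. case_prod (M (r n)) k) \<longlonglongrightarrow> l k"
    by (elim exE conjE)
  have l: "(\<lambda>n. M (r n) i j) \<longlonglongrightarrow> l (i, j)" if "i \<in> ?V" "j \<in> ?V" for i j
    using bspec[OF lk, of "(i, j)"] that by simp
  have "h \<longlonglongrightarrow> 0" unfolding h_def by (rule LIMSEQ_inverse_real_of_nat)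
  then have hr: "(\<lambda>n. h (r n)) \<longlonglongrightarrow> 0"
    using LIMSEQ_subseq_LIMSEQ[OF _ r, of h 0] by (simp add: o_def)
  have "psd_on ?V (\<lambda>i j. l (i, j))" unfolding psd_on_def
  proof (intro conjI ballI allI)
    fix i j assume ij: "i \<in> ?V" "j \<in> ?V"
    then have "(\<lambda>n. M (r n) i j) = (\<lambda>n. M (r n) j i)" using M(1) unfolding psd_on_def by auto
    with l[OF ij] l[OF ij(2,1)] show "l (i, j) = l (j, i)" using LIMSEQ_unique by metis
  next
    fix x :: "'a \<Rightarrow> real"
    have "(\<lambda>n. \<Sum>i\<in>?V. \<Sum>j\<in>?V. x i * M (r n) i j * x j) \<longlonglongrightarrow> (\<Sum>i\<in>?V. \<Sum>j\<in>?V. x i * l (i, j) * x j)"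
      by (intro tendsto_sum tendsto_mult tendsto_const l)
    then show "0 \<le> (\<Sum>i\<in>?V. \<Sum>j\<in>?V. x i * l (i, j) * x j)"
      by (rule LIMSEQ_le_const) (use M(1)[unfolded psd_on_def] in blast)
  qed
  moreover have "l (i, i) = A (Inl i) + e" if "i \<in> ?V" for i
  proof -
    have "(\<lambda>n. A (Inl i) + (e + h (r n))) \<longlonglongrightarrow> A (Inl i) + (e + 0)"
      by (intro tendsto_add tendsto_const hr)
    moreover have "(\<lambda>n. A (Inl i) + (e + h (r n))) \<longlonglongrightarrow> l (i, i)"
      using l[OF that that] M(2)[OF that] by simp
    ultimately show ?thesis using LIMSEQ_unique by fastforce
  qed
  moreover have "l (i, j) = A (Inr {i, j})" if "{i, j} \<in> edges G" for i j
    using l[OF edge_verts(1,2)[OF G that]] M(3)[OF that] by (simp add: LIMSEQ_const_iff)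
  ultimately show "\<exists>M. psd_on ?V M \<and> (\<forall>i\<in>?V. M i i = A (Inl i) + e) \<and>
      (\<forall>i j. {i, j} \<in> edges G \<longrightarrow> M i j = A (Inr {i, j}))" by blast
qed

lemma conical_distance_least:
  assumes G: "simple_graph G"
  shows "shift_ok G (conical_distance G)"
    and "\<And>\<epsilon>. shift_ok G \<epsilon> \<Longrightarrow> conical_distance G \<le> \<epsilon>"
proof -
  define m where "m = Inf {\<epsilon>. shift_ok G \<epsilon>}"
  have ne: "{\<epsilon>. shift_ok G \<epsilon>} \<noteq> {}" using shift_ok_card[OF G] by blast
  have bdd: "bdd_below {\<epsilon>. shift_ok G \<epsilon>}" by (rule bdd_belowI[of _ 0]) (simp add: shift_ok_def)
  have lower: "m \<le> \<epsilon>" if "shift_ok G \<epsilon>" for \<epsilon>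
    unfolding m_def using that bdd by (simp add: cInf_lower)
  have "0 \<le> m" unfolding m_def using ne by (intro cInf_greatest) (auto simp: shift_ok_def)
  moreover have "shift_ok G d" if "m < d" for d
  proof -
    obtain c where "shift_ok G c" "c < d" using cInf_lessD[OF ne, of d] \<open>m < d\<close> unfolding m_def by blast
    then show ?thesis using shift_ok_mono[OF G] by simp
  qed
  ultimately have m: "shift_ok G m" using shift_ok_limit[OF G] by blast
  have "conical_distance G = m" unfolding conical_distance_def
    using m lower by (rule Least_equality)
  with m lower show "shift_ok G (conical_distance G)"
    and "\<And>\<epsilon>. shift_ok G \<epsilon> \<Longrightarrow> conical_distance G \<le> \<epsilon>" by auto
qed

end

theory Submission
  imports Defs
begin

text \<open>A shift by \<open>\<epsilon>\<close> is admissible for \<open>G\<close> iff it is admissible for the cone. To extend a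
  matrix from \<open>G\<close> to the cone one pads with a zero row and column. In the other direction one passes to the
  Schur complement \<open>B - v v\<^sup>T / a\<close> with respect to the apex, where \<open>a\<close> is the diagonal entry and \<open>v\<close>
  the row of the apex: it is again clique-wise positive semidefinite, since a clique together with
  the apex is a clique of the cone, and its trace is at most one. If \<open>M\<close> completes its shift by \<open>\<epsilon>\<close>,
  then \<open>(\<epsilon> \<oplus> M) + (a, v)(a, v)\<^sup>T / a\<close> completes the shift of the original matrix.\<close>

section \<open>Admissible shifts in terms of total matrices\<close>

definition clique_psd :: "'a ugraph \<Rightarrow> ('a \<Rightarrow> 'a \<Rightarrow> real) \<Rightarrow> bool" where
  "clique_psd G B \<longleftrightarrow> (\<forall>K. clique G K \<longrightarrow> psd_on K B)"

text \<open>Here and in \<open>clique_psd\<close>, a total matrix \<open>B\<close> stands for a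
  partial one: only its values on vertices and edges matter. This makes block constructions and
  Schur complements plain formulas.\<close>

definition completable :: "'a ugraph \<Rightarrow> ('a \<Rightarrow> 'a \<Rightarrow> real) \<Rightarrow> real \<Rightarrow> bool" where
  "completable G B \<epsilon> \<longleftrightarrow> (\<exists>M. psd_on (verts G) M \<and> (\<forall>i\<in>verts G. M i i = B i i + \<epsilon>) \<and>
     (\<forall>i j. {i, j} \<in> edges G \<longrightarrow> M i j = B i j))"

lemma clique_singleton: "i \<in> verts G \<Longrightarrow> clique G {i}"
  by (simp add: clique_def)

lemma clique_edge: "simple_graph G \<Longrightarrow> {i, j} \<in> edges G \<Longrightarrow> clique G {i, j}"
  using edge_verts[of G i j] by (simp add: clique_def insert_commute)

lemma finite_clique: "simple_graph G \<Longrightarrow> clique G K \<Longrightarrow> finite K"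
  unfolding clique_def simple_graph_def by (metis finite_subset)

lemma psd_onD:
  assumes "psd_on S M"
  shows "i \<in> S \<Longrightarrow> j \<in> S \<Longrightarrow> M i j = M j i"
    and "0 \<le> (\<Sum>i\<in>S. \<Sum>j\<in>S. x i * M i j * x j)"
  using assms unfolding psd_on_def by blast+

lemma psd_on_cong:
  assumes "psd_on S M" "\<And>i j. i \<in> S \<Longrightarrow> j \<in> S \<Longrightarrow> M i j = N i j"
  shows "psd_on S N"
proof -
  have "(\<Sum>i\<in>S. \<Sum>j\<in>S. x i * N i j * x j) = (\<Sum>i\<in>S. \<Sum>j\<in>S. x i * M i j * x j)" for x
    using assms(2) by simp
  moreover have "N i j = N j i" if "i \<in> S" "j \<in> S" for i j
    using psd_onD(1)[OF assms(1) that] assms(2) that by simp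
  ultimately show ?thesis using psd_onD(2)[OF assms(1)] unfolding psd_on_def by simp
qed

lemma psd_on_scale:
  assumes "psd_on S M" "0 \<le> c"
  shows "psd_on S (\<lambda>i j. c * M i j)"
proof -
  have "(\<Sum>i\<in>S. \<Sum>j\<in>S. x i * (c * M i j) * x j) = c * (\<Sum>i\<in>S. \<Sum>j\<in>S. x i * M i j * x j)" for x
    by (simp add: sum_distrib_left mult_ac)
  then show ?thesis using assms unfolding psd_on_def by simp
qed

lemma clique_psd_diag:
  assumes "clique_psd G B" "i \<in> verts G"
  shows "0 \<le> B i i"
  using psd_on_diag[of "{i}" B i] assms by (auto simp: clique_psd_def clique_singleton)

lemma clique_psd_sym:
  assumes "simple_graph G" "clique_psd G B" "{i, j} \<in> edges G"
  shows "B i j = B j i"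
  using assms clique_edge[OF assms(1,3)] by (auto simp: clique_psd_def psd_on_def)

lemma partial_matrix_of:
  assumes G: "simple_graph G" and B: "clique_psd G B"
  obtains A where "A \<in> Sym_sp G" "\<And>i. i \<in> verts G \<Longrightarrow> A (Inl i) = B i i"
    "\<And>i j. {i, j} \<in> edges G \<Longrightarrow> A (Inr {i, j}) = B i j"
proof -
  \<comment> \<open>An edge is unordered, so its entry is read off from an arbitrary ordering of its
    ends. The choice is harmless because \<open>B\<close> is symmetric on edges, an edge being a
    clique.\<close>
  define b where "b e = (SOME c. \<exists>i j. e = {i, j} \<and> c = B i j)" for e
  define A where "A = restrict (case_sum (\<lambda>i. B i i) b) (verts G <+> edges G)"
  have b: "b {i, j} = B i j" if "{i, j} \<in> edges G" for i j
  proof -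
    have "\<exists>k l. {i, j} = {k, l} \<and> b {i, j} = B k l"
      unfolding b_def by (rule someI[of _ "B i j"]) blast
    then show ?thesis using clique_psd_sym[OF G B that] by (auto simp: doubleton_eq_iff)
  qed
  show thesis
    by (rule that[of A]) (auto simp: A_def Sym_sp_def b InlI InrI)
qed

text \<open>Moves the problem from \<open>Sym_sp\<close> to total matrices. Testing all cliques
  instead of the maximal ones changes nothing, since every clique extends to a maximal one and
  principal submatrices inherit positive semidefiniteness.\<close>

lemma shift_ok_iff_completable:
  assumes G: "simple_graph G"
  shows "shift_ok G \<epsilon> \<longleftrightarrow> 0 \<le> \<epsilon> \<and>
    (\<forall>B. clique_psd G B \<longrightarrow> (\<Sum>i\<in>verts G. B i i) = 1 \<longrightarrow> completable G B \<epsilon>)"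
proof (intro iffI conjI allI impI)
  assume ok: "shift_ok G \<epsilon>"
  then show "0 \<le> \<epsilon>" by (simp add: shift_ok_def)
  fix B assume B: "clique_psd G B" and tr: "(\<Sum>i\<in>verts G. B i i) = 1"
  obtain A where A: "A \<in> Sym_sp G" "\<And>i. i \<in> verts G \<Longrightarrow> A (Inl i) = B i i"
    "\<And>i j. {i, j} \<in> edges G \<Longrightarrow> A (Inr {i, j}) = B i j"
    using partial_matrix_of[OF G B] by blast
  have "psd_on K (entry A)" if "maximal_clique G K" for K
  proof (rule psd_on_cong)
    have K: "clique G K" using that by (simp add: maximal_clique_def)
    then show "psd_on K B" using B by (simp add: clique_psd_def)
    show "B i j = entry A i j" if "i \<in> K" "j \<in> K" for i j
    proof (cases "i = j")
      case True
      then show ?thesis using A(2)[of i] K that by (auto simp: entry_def clique_def)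
    next
      case False
      then have "{i, j} \<in> edges G" using K that by (simp add: clique_def)
      then show ?thesis using A(3) False by (simp add: entry_def)
    qed
  qed
  then have "A \<in> P_bar G" using A tr by (simp add: P_bar_def P_cone_def ptrace_def)
  then obtain M where M: "psd_on (verts G) M" "\<And>i. i \<in> verts G \<Longrightarrow> M i i = A (Inl i) + \<epsilon>"
    "\<And>i j. {i, j} \<in> edges G \<Longrightarrow> M i j = A (Inr {i, j})"
    using ok unfolding shift_ok_def shift_in_Sigma_iff[OF G] by blast
  have "M i i = B i i + \<epsilon>" if "i \<in> verts G" for i
    using M(2)[OF that] A(2)[OF that] by simp
  moreover have "M i j = B i j" if "{i, j} \<in> edges G" for i j
    using M(3)[OF that] A(3)[OF that] by simp
  ultimately show "completable G B \<epsilon>" using M(1) unfolding completable_def by blast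
next
  assume r: "0 \<le> \<epsilon> \<and>
    (\<forall>B. clique_psd G B \<longrightarrow> (\<Sum>i\<in>verts G. B i i) = 1 \<longrightarrow> completable G B \<epsilon>)"
  show "shift_ok G \<epsilon>" unfolding shift_ok_def shift_in_Sigma_iff[OF G]
  proof (intro conjI ballI)
    show "0 \<le> \<epsilon>" using r by blast
    fix A assume A: "A \<in> P_bar G"
    then have "completable G (entry A) \<epsilon>"
      using r P_bar_clique_psd[OF G A]
      by (auto simp: clique_psd_def entry_def P_bar_def ptrace_def)
    then obtain M where M: "psd_on (verts G) M" "\<And>i. i \<in> verts G \<Longrightarrow> M i i = entry A i i + \<epsilon>"
      "\<And>i j. {i, j} \<in> edges G \<Longrightarrow> M i j = entry A i j" unfolding completable_def by blast
    have "M i j = A (Inr {i, j})" if "{i, j} \<in> edges G" for i j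
      using M(3)[OF that] edge_verts(3)[OF G that] by (simp add: entry_def)
    moreover have "M i i = A (Inl i) + \<epsilon>" if "i \<in> verts G" for i
      using M(2)[OF that] by (simp add: entry_def)
    ultimately show "\<exists>M. psd_on (verts G) M \<and> (\<forall>i\<in>verts G. M i i = A (Inl i) + \<epsilon>) \<and>
        (\<forall>i j. {i, j} \<in> edges G \<longrightarrow> M i j = A (Inr {i, j}))" using M(1) by blast
  qed
qed

lemma completable_mono:
  assumes G: "simple_graph G" and "completable G B d" "d \<le> \<epsilon>"
  shows "completable G B \<epsilon>"
proof -
  from assms(2) obtain M where M: "psd_on (verts G) M" "\<forall>i\<in>verts G. M i i = B i i + d"
    "\<forall>i j. {i, j} \<in> edges G \<longrightarrow> M i j = B i j" unfolding completable_def by blast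
  have "psd_on (verts G) (\<lambda>i j. M i j + (if i = j then \<epsilon> - d else 0))"
    using psd_on_add_diag[OF _ M(1)] G assms(3) by (simp add: simple_graph_def)
  then show ?thesis unfolding completable_def
    by (rule exI[where P = "\<lambda>M. psd_on (verts G) M \<and> _ M", OF conjI])
      (use M in \<open>auto simp: singleton_not_edge[OF G]\<close>)
qed

text \<open>Needed because a Schur complement may lose trace. Rescaling to trace one, completing and
  scaling back costs only a shift by \<open>t * \<epsilon>\<close>, where \<open>t\<close> is the
  trace, and this is at most \<open>\<epsilon>\<close>.\<close>

lemma completable_trace_le_1:
  assumes G: "simple_graph G" and ok: "shift_ok G \<epsilon>" and B: "clique_psd G B"
    and tr: "(\<Sum>i\<in>verts G. B i i) \<le> 1"
  shows "completable G B \<epsilon>"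
proof -
  define t where "t = (\<Sum>i\<in>verts G. B i i)"
  have fin: "finite (verts G)" using G by (simp add: simple_graph_def)
  have \<epsilon>: "0 \<le> \<epsilon>" using ok by (simp add: shift_ok_def)
  have t0: "0 \<le> t" unfolding t_def by (intro sum_nonneg clique_psd_diag[OF B])
  have "completable G B (t * \<epsilon>)"
  proof (cases "t = 0")
    case True
    have z: "B i i = 0" if "i \<in> verts G" for i
      using True that fin clique_psd_diag[OF B] sum_nonneg_eq_0_iff[of "verts G" "\<lambda>i. B i i"]
      unfolding t_def by blast
    \<comment> \<open>On an edge, twice the absolute value of the entry is at most the sum of the
      two diagonal entries, which vanish here.\<close>
    have "B i j = 0" if "{i, j} \<in> edges G" for i j
      using psd_on_entry[of "{i, j}" B i j] B clique_edge[OF G that] z edge_verts[OF G that]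
      by (auto simp: clique_psd_def)
    with z True show ?thesis unfolding completable_def
      by (intro exI[of _ "\<lambda>_ _. 0"]) (simp add: psd_on_def)
  next
    case False
    define C where "C i j = inverse t * B i j" for i j
    have "clique_psd G C" using B t0 psd_on_scale[of _ B "inverse t"]
      by (simp add: clique_psd_def C_def[abs_def])
    moreover have "(\<Sum>i\<in>verts G. C i i) = 1"
      using False by (simp add: C_def flip: sum_distrib_left t_def)
    ultimately obtain M where M: "psd_on (verts G) M" "\<forall>i\<in>verts G. M i i = C i i + \<epsilon>"
      "\<forall>i j. {i, j} \<in> edges G \<longrightarrow> M i j = C i j"
      using ok unfolding shift_ok_iff_completable[OF G] completable_def by blast
    have "psd_on (verts G) (\<lambda>i j. t * M i j)" using psd_on_scale[OF M(1) t0] .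
    then show ?thesis unfolding completable_def
      by (rule exI[where P = "\<lambda>M. psd_on (verts G) M \<and> _ M", OF conjI])
        (use M False in \<open>auto simp: C_def algebra_simps\<close>)
  qed
  moreover have "t * \<epsilon> \<le> \<epsilon>" using tr \<epsilon> unfolding t_def by (simp add: mult_left_le_one_le t0[unfolded t_def])
  ultimately show ?thesis by (rule completable_mono[OF G])
qed

section \<open>Edges and cliques of the cone\<close>

lemma verts_cone [simp]: "verts (cone_graph G) = insert None (Some ` verts G)"
  by (simp add: cone_graph_def)

lemma edges_cone_Some [simp]: "{Some i, Some j} \<in> edges (cone_graph G) \<longleftrightarrow> {i, j} \<in> edges G"
proof -
  have "{Some i, Some j} = Some ` {i, j}" by simp
  then have "{Some i, Some j} \<in> (\<lambda>e. Some ` e) ` edges G \<longleftrightarrow> {i, j} \<in> edges G"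
    by (metis (no_types) inj_Some inj_image_eq_iff image_iff)
  then show ?thesis by (auto simp: cone_graph_def doubleton_eq_iff)
qed

lemma edges_cone_None [simp]:
  "{None, Some i} \<in> edges (cone_graph G) \<longleftrightarrow> i \<in> verts G"
  "{Some i, None} \<in> edges (cone_graph G) \<longleftrightarrow> i \<in> verts G"
  by (auto simp: cone_graph_def doubleton_eq_iff)

lemma clique_cone_insert: "clique G K \<Longrightarrow> clique (cone_graph G) (insert None (Some ` K))"
  by (auto simp: clique_def)

text \<open>Reduces clique conditions on the cone to cliques of \<open>G\<close> with the apex
  added. There is only an inclusion because \<open>L\<close> may omit the apex.\<close>

lemma clique_cone_cases:
  assumes "clique (cone_graph G) L"
  obtains K where "clique G K" "L \<subseteq> insert None (Some ` K)"
proof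
  let ?K = "{i. Some i \<in> L}"
  show "clique G ?K" unfolding clique_def
  proof (intro conjI ballI impI)
    show "?K \<subseteq> verts G" using assms by (auto simp: clique_def)
    fix i j assume "i \<in> ?K" "j \<in> ?K" "i \<noteq> j"
    then have "{Some i, Some j} \<in> edges (cone_graph G)" using assms unfolding clique_def by blast
    then show "{i, j} \<in> edges G" by simp
  qed
  show "L \<subseteq> insert None (Some ` ?K)"
  proof
    fix k assume "k \<in> L"
    then show "k \<in> insert None (Some ` ?K)" by (cases k) auto
  qed
qed

section \<open>Quadratic forms with a distinguished apex coordinate\<close>

lemma sum_option:
  fixes f :: "'a option \<Rightarrow> real"
  assumes "finite S"
  shows "(\<Sum>i\<in>insert None (Some ` S). f i) = f None + (\<Sum>i\<in>S. f (Some i))"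
  using assms by (simp add: sum.reindex image_iff)

lemma quadratic_form_option:
  fixes M :: "'a option \<Rightarrow> 'a option \<Rightarrow> real"
  assumes "finite S" "\<And>i. i \<in> S \<Longrightarrow> M (Some i) None = M None (Some i)"
  defines "T \<equiv> insert None (Some ` S)"
  shows "(\<Sum>i\<in>T. \<Sum>j\<in>T. x i * M i j * x j) =
    M None None * (x None)\<^sup>2 + 2 * x None * (\<Sum>i\<in>S. M None (Some i) * x (Some i)) +
    (\<Sum>i\<in>S. \<Sum>j\<in>S. x (Some i) * M (Some i) (Some j) * x (Some j))"
proof -
  have "(\<Sum>i\<in>S. x (Some i) * M (Some i) None * x None) = x None * (\<Sum>i\<in>S. M None (Some i) * x (Some i))"
    by (simp add: assms(2) sum_distrib_left mult_ac)
  moreover have "(\<Sum>i\<in>S. x None * M None (Some i) * x (Some i)) = x None * (\<Sum>i\<in>S. M None (Some i) * x (Some i))"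
    by (simp add: sum_distrib_left mult_ac)
  ultimately show ?thesis
    unfolding T_def sum_option[OF assms(1)] by (simp add: sum.distrib power2_eq_square)
qed

text \<open>Used with \<open>c = - 1 / a\<close> to form a Schur complement and with
  \<open>c = 1 / a\<close> to undo it.\<close>

lemma quadratic_form_rank_one:
  fixes v x :: "'a \<Rightarrow> real"
  shows "(\<Sum>i\<in>S. \<Sum>j\<in>S. x i * (B i j + c * (v i * v j)) * x j) =
    (\<Sum>i\<in>S. \<Sum>j\<in>S. x i * B i j * x j) + c * (\<Sum>i\<in>S. v i * x i)\<^sup>2"
  by (simp add: algebra_simps sum.distrib sum_distrib_left power2_eq_square sum_product)

text \<open>For \<open>M None None = 0\<close> the quotient is \<open>0\<close>, and the claim is about a principal submatrix.\<close>

lemma psd_on_Schur_complement: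
  fixes M :: "'a option \<Rightarrow> 'a option \<Rightarrow> real"
  assumes "finite S" and psd: "psd_on (insert None (Some ` S)) M"
  shows "psd_on S (\<lambda>i j. M (Some i) (Some j) - M None (Some i) * M None (Some j) / M None None)"
  unfolding psd_on_def
proof (intro conjI allI)
  let ?a = "M None None" and ?v = "\<lambda>i. M None (Some i)"
  show "\<forall>i\<in>S. \<forall>j\<in>S. M (Some i) (Some j) - ?v i * ?v j / ?a = M (Some j) (Some i) - ?v j * ?v i / ?a"
  proof (intro ballI)
    fix i j assume "i \<in> S" "j \<in> S"
    then have "M (Some i) (Some j) = M (Some j) (Some i)" by (intro psd_onD(1)[OF psd]) auto
    then show "M (Some i) (Some j) - ?v i * ?v j / ?a = M (Some j) (Some i) - ?v j * ?v i / ?a"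
      by (simp only: mult.commute)
  qed
  fix x :: "'a \<Rightarrow> real"
  let ?s = "\<Sum>i\<in>S. ?v i * x i"
  let ?q = "\<Sum>i\<in>S. \<Sum>j\<in>S. x i * M (Some i) (Some j) * x j"
  \<comment> \<open>For a positive apex entry, this apex coordinate minimises the quadratic form
    with \<open>x\<close> held fixed; the minimum is the form of the Schur complement.\<close>
  define y where "y = case_option (- ?s / ?a) x"
  have "0 \<le> ?a * (y None)\<^sup>2 + 2 * y None * (\<Sum>i\<in>S. ?v i * y (Some i)) +
    (\<Sum>i\<in>S. \<Sum>j\<in>S. y (Some i) * M (Some i) (Some j) * y (Some j))"
    by (subst quadratic_form_option[symmetric])
      (fact, (rule psd_onD(1)[OF psd]; simp), rule psd_onD(2)[OF psd])
  also have "\<dots> = ?q + (- 1 / ?a) * ?s\<^sup>2"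
    by (cases "?a = 0") (simp_all add: y_def field_simps power2_eq_square)
  also have "\<dots> = (\<Sum>i\<in>S. \<Sum>j\<in>S. x i * (M (Some i) (Some j) - ?v i * ?v j / ?a) * x j)"
    by (subst quadratic_form_rank_one[symmetric]) simp
  finally show "0 \<le> (\<Sum>i\<in>S. \<Sum>j\<in>S. x i * (M (Some i) (Some j) - ?v i * ?v j / ?a) * x j)" .
qed

text \<open>The matrix is the block sum of \<open>e\<close> and \<open>M\<close> plus the rank one
  matrix with corner \<open>a\<close>, apex row \<open>v\<close> and block
  \<open>v i * v j / a\<close>. If \<open>a = 0\<close>, then \<open>v\<close> must vanish to remove
  the cross term. With \<open>a = e = 0\<close> the construction is padding by zeros.\<close>

lemma psd_on_option_rank_one:
  fixes v :: "'a \<Rightarrow> real"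
  assumes "finite S" and psd: "psd_on S M" and "0 \<le> a" "0 \<le> e"
    and v: "\<And>i. a = 0 \<Longrightarrow> i \<in> S \<Longrightarrow> v i = 0"
  shows "psd_on (insert None (Some ` S)) (\<lambda>i j. case i of
      None \<Rightarrow> (case j of None \<Rightarrow> a + e | Some j \<Rightarrow> v j)
    | Some i \<Rightarrow> (case j of None \<Rightarrow> v i | Some j \<Rightarrow> M i j + v i * v j / a))"
    (is "psd_on ?T ?N")
  unfolding psd_on_def
proof (intro conjI allI)
  show "\<forall>i\<in>?T. \<forall>j\<in>?T. ?N i j = ?N j i"
    by (auto simp: mult.commute intro: psd_onD(1)[OF psd])
  fix x :: "'a option \<Rightarrow> real"
  let ?s = "\<Sum>i\<in>S. v i * x (Some i)"
  let ?q = "\<Sum>i\<in>S. \<Sum>j\<in>S. x (Some i) * M i j * x (Some j)"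
  have "(\<Sum>i\<in>?T. \<Sum>j\<in>?T. x i * ?N i j * x j) = (a + e) * (x None)\<^sup>2 + 2 * x None * ?s +
      (\<Sum>i\<in>S. \<Sum>j\<in>S. x (Some i) * (M i j + 1 / a * (v i * v j)) * x (Some j))"
    using assms(1) by (subst quadratic_form_option) simp_all
  also have "\<dots> = (a + e) * (x None)\<^sup>2 + 2 * x None * ?s + (?q + 1 / a * ?s\<^sup>2)"
    by (simp only: quadratic_form_rank_one[of "\<lambda>i. x (Some i)"])
  \<comment> \<open>Completes the square in the apex coordinate; for \<open>a = 0\<close> both
    quotients are zero by convention.\<close>
  also have "\<dots> = ?q + e * (x None)\<^sup>2 + (a * x None + ?s)\<^sup>2 / a"
  proof (cases "a = 0")
    case True
    with v have "?s = 0" by simp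
    with True show ?thesis by simp
  next
    case False
    then show ?thesis by (simp add: field_simps power2_eq_square)
  qed
  also have "\<dots> \<ge> 0" using psd_onD(2)[OF psd, of "\<lambda>i. x (Some i)"] assms(3,4) by simp
  finally show "0 \<le> (\<Sum>i\<in>?T. \<Sum>j\<in>?T. x i * ?N i j * x j)" .
qed

lemma psd_on_zero_diag:
  assumes "finite S" "psd_on S M" "i \<in> S" "j \<in> S" "M i i = 0"
  shows "M i j = 0"
proof (cases "i = j")
  case False
  have psd: "psd_on {i, j} M" using psd_on_subset[OF assms(1,2)] assms(3,4) by simp
  then have sym: "M j i = M i j" by (rule psd_onD(1)) simp_all
  show ?thesis
  proof (rule ccontr)
    assume nz: "M i j \<noteq> 0"
    \<comment> \<open>As \<open>M i i = 0\<close>, the form on the pair is affine in the coordinate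
      at \<open>i\<close>, with slope \<open>2 * M i j\<close>. This value of the coordinate makes
      the form negative.\<close>
    define x where "x k = (if k = i then - (M j j + 1) / M i j else 1)" for k
    have "0 \<le> (\<Sum>k\<in>{i, j}. \<Sum>l\<in>{i, j}. x k * M k l * x l)"
      using psd by (rule psd_onD(2))
    also have "\<dots> = - M j j - 2"
      using False nz assms(5) sym by (simp add: x_def field_simps)
    finally show False using psd_on_diag[OF assms(1,2,4)] by simp
  qed
next
  case True
  then show ?thesis using assms(5) by metis
qed

section \<open>Comparison of the shifts of a graph and its cone\<close>

lemma shift_ok_cone_imp:
  assumes G: "simple_graph G" and ok: "shift_ok (cone_graph G) \<epsilon>"
  shows "shift_ok G \<epsilon>"
  unfolding shift_ok_iff_completable[OF G]
proof (intro conjI allI impI)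
  note G' = simple_graph_cone[OF G]
  show "0 \<le> \<epsilon>" using ok by (simp add: shift_ok_def)
  fix B assume B: "clique_psd G B" and tr: "(\<Sum>i\<in>verts G. B i i) = 1"
  have fin: "finite (verts G)" using G by (simp add: simple_graph_def)
  \<comment> \<open>Padding by a zero apex row and column keeps the trace equal to one.\<close>
  define C where "C i j = (case i of None \<Rightarrow> 0 | Some i \<Rightarrow> (case j of None \<Rightarrow> 0 | Some j \<Rightarrow> B i j))" for i j
  have "clique_psd (cone_graph G) C" unfolding clique_psd_def
  proof (intro allI impI)
    fix L assume "clique (cone_graph G) L"
    then obtain K where K: "clique G K" "L \<subseteq> insert None (Some ` K)"
      by (rule clique_cone_cases)
    have "psd_on (insert None (Some ` K)) C"
      by (rule psd_on_cong[OF psd_on_option_rank_one[of K B 0 0 "\<lambda>_. 0"]])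
        (use finite_clique[OF G K(1)] B K(1) in \<open>auto simp: clique_psd_def C_def\<close>)
    then show "psd_on L C"
      by (rule psd_on_subset[rotated]) (use K finite_clique[OF G K(1)] in auto)
  qed
  moreover have "(\<Sum>i\<in>verts (cone_graph G). C i i) = 1"
    using tr unfolding verts_cone sum_option[OF fin] by (simp add: C_def)
  ultimately obtain M where M: "psd_on (insert None (Some ` verts G)) M"
    "\<forall>i\<in>verts (cone_graph G). M i i = C i i + \<epsilon>"
    "\<forall>i j. {i, j} \<in> edges (cone_graph G) \<longrightarrow> M i j = C i j"
    using ok unfolding shift_ok_iff_completable[OF G'] completable_def by auto
  \<comment> \<open>The principal submatrix on the copy of \<open>G\<close> completes the original
    shift.\<close>
  define N where "N i j = M (Some i) (Some j)" for i j
  have psd: "psd_on (Some ` verts G) M" by (rule psd_on_subset[OF _ M(1)]) (use fin in auto)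
  have "psd_on (verts G) N" unfolding psd_on_def
  proof (intro conjI allI ballI)
    show "N i j = N j i" if "i \<in> verts G" "j \<in> verts G" for i j
      unfolding N_def using that by (intro psd_onD(1)[OF psd]) auto
    show "0 \<le> (\<Sum>i\<in>verts G. \<Sum>j\<in>verts G. x i * N i j * x j)" for x
      using psd_onD(2)[OF psd, of "\<lambda>i. x (the i)"] by (simp add: sum.reindex N_def)
  qed
  moreover have "N i i = B i i + \<epsilon>" if "i \<in> verts G" for i using M(2) that by (simp add: N_def C_def)
  moreover have "N i j = B i j" if "{i, j} \<in> edges G" for i j using M(3) that by (simp add: N_def C_def)
  ultimately show "completable G B \<epsilon>" unfolding completable_def by blast
qed

lemma shift_ok_imp_cone:
  assumes G: "simple_graph G" and ok: "shift_ok G \<epsilon>"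
  shows "shift_ok (cone_graph G) \<epsilon>"
  unfolding shift_ok_iff_completable[OF simple_graph_cone[OF G]]
proof (intro conjI allI impI)
  note G' = simple_graph_cone[OF G]
  show \<epsilon>: "0 \<le> \<epsilon>" using ok by (simp add: shift_ok_def)
  fix B assume B: "clique_psd (cone_graph G) B" and tr: "(\<Sum>i\<in>verts (cone_graph G). B i i) = 1"
  have fin: "finite (verts G)" using G by (simp add: simple_graph_def)
  define a where "a = B None None"
  define v where "v i = B None (Some i)" for i
  define C where "C i j = B (Some i) (Some j) - v i * v j / a" for i j
  have a: "0 \<le> a" unfolding a_def by (rule clique_psd_diag[OF B]) simp
  have sym: "B (Some i) None = v i" if "i \<in> verts G" for i
    using clique_psd_sym[OF G' B] that by (simp add: v_def)
  \<comment> \<open>A zero apex entry forces a zero apex row, so \<open>C\<close> is then just the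
    block of \<open>B\<close> on the copy of \<open>G\<close>, and the rank one construction still
    applies.\<close>
  have v: "v i = 0" if "a = 0" "i \<in> verts G" for i
    using psd_on_zero_diag[of "{None, Some i}" B None "Some i"] that B clique_edge[OF G', of None "Some i"]
    by (simp add: a_def v_def clique_psd_def)
  have "clique_psd G C" unfolding clique_psd_def
  proof (intro allI impI)
    fix K assume K: "clique G K"
    show "psd_on K C"
      using psd_on_Schur_complement[OF finite_clique[OF G K], of B] B clique_cone_insert[OF K]
      by (simp add: C_def[abs_def] a_def v_def clique_psd_def)
  qed
  moreover have "(\<Sum>i\<in>verts G. C i i) \<le> 1"
  proof -
    \<comment> \<open>The Schur complement subtracts the nonnegative \<open>v i * v i / a\<close>
      from each diagonal entry; dropping the apex entry \<open>a\<close> loses further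
      trace.\<close>
    have "(\<Sum>i\<in>verts G. C i i) \<le> (\<Sum>i\<in>verts G. B (Some i) (Some i))"
      using a by (intro sum_mono) (simp add: C_def)
    also have "\<dots> \<le> 1" using tr[unfolded verts_cone sum_option[OF fin]] a by (simp add: a_def)
    finally show ?thesis .
  qed
  ultimately have "completable G C \<epsilon>" by (rule completable_trace_le_1[OF G ok])
  then obtain M where M: "psd_on (verts G) M" "\<And>i. i \<in> verts G \<Longrightarrow> M i i = C i i + \<epsilon>"
    "\<And>i j. {i, j} \<in> edges G \<Longrightarrow> M i j = C i j" unfolding completable_def by blast
  \<comment> \<open>Adding \<open>v i * v j / a\<close> back turns entries of \<open>C\<close> into
    entries of \<open>B\<close>. The corner is \<open>a + \<epsilon>\<close> because the apex entry
    is shifted too.\<close>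
  define N where "N = (\<lambda>i j. case i of
      None \<Rightarrow> (case j of None \<Rightarrow> a + \<epsilon> | Some j \<Rightarrow> v j)
    | Some i \<Rightarrow> (case j of None \<Rightarrow> v i | Some j \<Rightarrow> M i j + v i * v j / a))"
  have "psd_on (verts (cone_graph G)) N"
    unfolding N_def verts_cone
    by (intro psd_on_option_rank_one) (fact fin M(1) a \<epsilon> v)+
  moreover have "N i i = B i i + \<epsilon>" if "i \<in> verts (cone_graph G)" for i
    using that M(2) by (auto simp: N_def a_def C_def)
  moreover have "N i j = B i j" if "{i, j} \<in> edges (cone_graph G)" for i j
  proof (cases i; cases j)
    assume "i = None" "j = None"
    then show ?thesis using that singleton_not_edge[OF G'] by simp
  next
    fix l assume "i = None" "j = Some l"
    then show ?thesis by (simp add: N_def v_def)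
  next
    fix k assume "i = Some k" "j = None"
    then show ?thesis using that sym by (simp add: N_def)
  next
    fix k l assume "i = Some k" "j = Some l"
    then show ?thesis using that M(3) by (simp add: N_def C_def)
  qed
  ultimately show "completable (cone_graph G) B \<epsilon>" unfolding completable_def by blast
qed

theorem theorem12:
  fixes G :: "'a ugraph"
  assumes "simple_graph G"
  shows "conical_distance (cone_graph G) = conical_distance G"
proof -
  \<comment> \<open>Both distances are then \<open>LEAST\<close> of one and the same
    predicate.\<close>
  have "shift_ok (cone_graph G) = shift_ok G"
    using shift_ok_cone_imp[OF assms] shift_ok_imp_cone[OF assms] by blast
  then show ?thesis by (simp add: conical_distance_def)
qed

end
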